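(* Let $n\ge1$ be an integer and $\zeta$ a transcendental real number with $w_n(\zeta)<\infty$. Then \[\lambda_N(\zeta)\le\max\Big\{\frac{1}{\widehat{w}_n(\zeta)},\frac{1}{\widehat{w}_{N-n+1}(\zeta)-w_n(\zeta)}\Big\}\qquad\text{for all } N\ge\lceil w_n(\zeta)\rceil+n-1.\] Moreover, if $w_n(\zeta)<2n+1$, then \[\lambda_N(\zeta)\le\max\Big\{\frac{1}{\widehat{w}_n(\zeta)},\frac{1}{\widehat{w}_{N-n+1}(\zeta)-w_{N-2n}(\zeta)}\Big\}\qquad\text{for all } \lfloor w_n(\zeta)\rfloor+n\le N\le 3n.\]
   Context: $H(P)$ is the maximum modulus of the coefficients of $P\in\mathbb{Z}[T]$. $w_n(\zeta)$: supremum of $w$ such that $0<|P(\zeta)|\le H(P)^{-w}$ has infinitely many solutions $P\in\mathbb{Z}[T]$ of degree $\le n$; by convention $w_0(\zeta)=0$. $\widehat{w}_n(\zeta)$: supremum of $w$ such that $H(P)\le X$, $0<|P(\zeta)|\le X^{-w}$ has a solution $P\in\mathbb{Z}[T]$ of degree $\le n$ for all large $X$. $\lambda_N(\zeta)$: supremum of $\lambda$ such that $1\le|x|\le X$, $\max_{1\le i\le N}|\zeta^ix-y_i|\le X^{-\lambda}$ has a solution $(x,y_1,\dots,y_N)\in\mathbb{Z}^{N+1}$ for arbitrarily large $X$. Convention: $1/0=\infty$. *)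

theory Defs
  imports Complex_Main "HOL-Library.Extended_Real" "HOL-Computational_Algebra.Polynomial"
begin

definition poly_height :: "int poly \<Rightarrow> int" where
  "poly_height P = Max ((\<lambda>i. \<bar>coeff P i\<bar>) ` {..degree P})"

abbreviation eval_at :: "int poly \<Rightarrow> real \<Rightarrow> real" where
  "eval_at P \<zeta> \<equiv> poly (map_poly real_of_int P) \<zeta>"

text \<open>The exponents are extended reals, since the suprema may be infinite. The case \<open>n = 0\<close> of
  \<open>w_exp\<close> is a convention; the supremum itself would be \<open>-1\<close> there.\<close>

definition w_exp :: "nat \<Rightarrow> real \<Rightarrow> ereal" where
  "w_exp n \<zeta> = (if n = 0 then 0 else
     Sup {ereal w | w. infinite {P :: int poly. degree P \<le> n \<and>
       0 < \<bar>eval_at P \<zeta>\<bar> \<and> \<bar>eval_at P \<zeta>\<bar> \<le> real_of_int (poly_height P) powr (- w)}})"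

definition w_hat_exp :: "nat \<Rightarrow> real \<Rightarrow> ereal" where
  "w_hat_exp n \<zeta> =
     Sup {ereal w | w. \<forall>\<^sub>F X :: real in at_top. \<exists>P :: int poly. degree P \<le> n \<and>
       real_of_int (poly_height P) \<le> X \<and>
       0 < \<bar>eval_at P \<zeta>\<bar> \<and> \<bar>eval_at P \<zeta>\<bar> \<le> X powr (- w)}"

definition lambda_exp :: "nat \<Rightarrow> real \<Rightarrow> ereal" where
  "lambda_exp N \<zeta> =
     Sup {ereal l | l. \<exists>\<^sub>F X :: real in at_top. \<exists>(x :: int) (y :: nat \<Rightarrow> int).
       1 \<le> \<bar>x\<bar> \<and> real_of_int \<bar>x\<bar> \<le> X \<and>
       (\<forall>i\<in>{1..N}. \<bar>\<zeta> ^ i * real_of_int x - real_of_int (y i)\<bar> \<le> X powr (- l))}"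

end

theory Submission
  imports Defs "Berlekamp_Zassenhaus.Factor_Bound"
begin

text \<open>
  Let \<open>(x, y\<^sub>1, \<dots>, y\<^sub>N)\<close> be a simultaneous approximation to the powers of \<open>\<zeta>\<close> with
  \<open>\<bar>x\<bar> \<le> X\<close> and error \<open>X\<^bsup>-l\<^esup>\<close>. The linear functional sending \<open>T\<^sup>i\<close> to \<open>y\<^sub>i\<close> (with \<open>y\<^sub>0 = x\<close>) takes
  integer values on integer polynomials of degree at most \<open>N\<close>, and it takes a value smaller than 1,
  hence 0, on \<open>T\<^sup>j F\<close> as soon as \<open>X \<bar>F(\<zeta>)\<bar>\<close> and \<open>X\<^bsup>-l\<^esup> H(F)\<close> are small. If this holds for two
  polynomials \<open>P\<close>, \<open>B\<close> without common factor and with \<open>deg P + deg B \<le> N + 1\<close>, then a Bezout identity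
  shows that the functional vanishes on a nonzero constant, so that \<open>x = 0\<close>.

  With \<open>Y\<close> slightly smaller than \<open>X\<^sup>l\<close>, the uniform exponents provide \<open>P\<close> of degree at most \<open>n\<close> and
  \<open>Q\<close> of degree at most \<open>N - n + 1\<close>, both of height at most \<open>Y\<close> and small at \<open>\<zeta>\<close>. Splitting the common
  factors off \<open>Q\<close> gives \<open>Q = A B\<close> with \<open>P\<close>, \<open>B\<close> without common factor and \<open>A\<close> a product of
  polynomials of degree at most \<open>n\<close>. Heights being multiplicative up to constants (Gelfond), \<open>\<bar>A(\<zeta>)\<bar>\<close> is
  at least about \<open>H(A)\<close> to the power \<open>-w\<^sub>n(\<zeta>)\<close>, and dividing by \<open>A\<close> loses at most this factor.
  If \<open>deg A > N - 2n\<close>, then \<open>deg B \<le> n\<close> as well and the same bound for \<open>A\<close> and \<open>B\<close> contradicts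
  the smallness of \<open>Q(\<zeta>)\<close> when \<open>w\<^sub>n(\<zeta>)\<close> is below the uniform exponent of degree \<open>N - n + 1\<close>; otherwise
  \<open>w\<^bsub>N-2n\<^esub>\<close> may replace \<open>w\<^sub>n\<close> in the bound for \<open>A\<close>.
\<close>

hide_const (open) up_ring.coeff up_ring.monom module.smult

section \<open>Heights and values of integer polynomials\<close>

lemma abs_coeff_le_height: "\<bar>coeff P i\<bar> \<le> poly_height P"
proof (cases "i \<le> degree P")
  case True
  then show ?thesis
    unfolding poly_height_def by (intro Max_ge) auto
next
  case False
  have "\<bar>coeff P 0\<bar> \<le> poly_height P"
    unfolding poly_height_def by (intro Max_ge) auto
  with False show ?thesis
    by (simp add: coeff_eq_0)
qed

lemma height_leI:
  assumes "\<And>i. \<bar>coeff P i\<bar> \<le> c"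
  shows "poly_height P \<le> c"
  unfolding poly_height_def using assms by (intro Max.boundedI) auto

lemma height_attained: "\<exists>i. poly_height P = \<bar>coeff P i\<bar>"
proof -
  have "poly_height P \<in> (\<lambda>i. \<bar>coeff P i\<bar>) ` {..degree P}"
    unfolding poly_height_def by (intro Max_in) auto
  then show ?thesis by auto
qed

lemma height_ge_1:
  assumes "P \<noteq> 0"
  shows "poly_height P \<ge> 1"
proof -
  have "\<bar>lead_coeff P\<bar> \<ge> 1" using assms by (smt (verit) leading_coeff_0_iff)
  then show ?thesis using abs_coeff_le_height[of P "degree P"] by linarith
qed

lemma height_one: "poly_height 1 = 1"
  by (simp add: poly_height_def)

lemma eval_at_mult: "eval_at (P * Q) z = eval_at P z * eval_at Q z"
  by (simp add: of_int_poly_hom.hom_mult)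

lemma eval_at_eq_sum:
  assumes "degree P \<le> N"
  shows "eval_at P z = (\<Sum>i\<le>N. real_of_int (coeff P i) * z ^ i)"
proof -
  have "eval_at P z = (\<Sum>i\<le>degree P. real_of_int (coeff P i) * z ^ i)"
    by (simp add: poly_altdef)
  also have "\<dots> = (\<Sum>i\<le>N. real_of_int (coeff P i) * z ^ i)"
    using assms by (intro sum.mono_neutral_left) (auto simp: coeff_eq_0)
  finally show ?thesis .
qed

lemma eval_at_transcendental_nonzero:
  assumes "\<not> algebraic z" "P \<noteq> 0"
  shows "eval_at P z \<noteq> 0"
proof
  assume "eval_at P z = 0"
  moreover have "map_poly real_of_int P \<noteq> 0" using assms by simp
  moreover have "coeff (map_poly real_of_int P) i \<in> \<int>" for i by simp
  ultimately have "algebraic z" by (intro algebraicI)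
  with assms show False by simp
qed

lemma abs_eval_at_const_ge_1:
  assumes "degree P = 0" "P \<noteq> 0"
  shows "\<bar>eval_at P z\<bar> \<ge> 1"
proof -
  obtain c where "P = [:c:]" using assms(1) degree_eq_zeroE by blast
  with assms show ?thesis by (simp add: map_poly_pCons)
qed

subsection \<open>Heights of products\<close>

text \<open>Landau's inequality bounds the Mahler measure by the Euclidean norm of the at most
  \<open>D + 1\<close> coefficients.\<close>

lemma mahler_measure_le_height:
  assumes "degree F \<le> D"
  shows "mahler_measure F \<le> (real D + 1) * real_of_int (poly_height F)"
proof -
  have H: "0 \<le> poly_height F" using abs_coeff_le_height[of F 0] by linarith
  have len: "length (coeffs F) \<le> D + 1" using assms by (cases "F = 0") (auto simp: length_coeffs)
  have "mahler_measure F \<le> l2norm_complex (of_int_poly F)"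
    unfolding mahler_measure_def by (rule Landau_inequality)
  also have "\<dots> = sqrt (\<Sum>a\<leftarrow>coeffs F. (real_of_int a)\<^sup>2)"
    by (simp add: o_def)
  also have "\<dots> \<le> sqrt (((real D + 1) * real_of_int (poly_height F))\<^sup>2)"
  proof (rule real_sqrt_le_mono)
    have "(real_of_int a)\<^sup>2 \<le> (real_of_int (poly_height F))\<^sup>2" if "a \<in> set (coeffs F)" for a
    proof -
      obtain i where "a = coeff F i" using \<open>a \<in> set (coeffs F)\<close>
        by (metis in_set_conv_nth nth_coeffs_coeff length_coeffs_degree
            coeffs_eq_Nil empty_iff empty_set le_degree less_Suc_eq_le)
      then have "\<bar>a\<bar> \<le> poly_height F" by (simp add: abs_coeff_le_height)
      then show ?thesis using H by (metis abs_le_square_iff abs_of_nonneg of_int_abs of_int_le_iff of_int_0_le_iff)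
    qed
    then have "(\<Sum>a\<leftarrow>coeffs F. (real_of_int a)\<^sup>2)
        \<le> (\<Sum>a\<leftarrow>coeffs F. (real_of_int (poly_height F))\<^sup>2)"
      by (intro sum_list_mono) auto
    also have "\<dots> = real (length (coeffs F)) * (real_of_int (poly_height F))\<^sup>2"
      by (simp add: sum_list_triv)
    also have "\<dots> \<le> (real D + 1) * (real_of_int (poly_height F))\<^sup>2"
      using len by (intro mult_right_mono) auto
    \<comment> \<open>The factor is squared only to get rid of the square root; the loss is harmless
      because constants do not affect exponents.\<close>
    also have "\<dots> \<le> (real D + 1)\<^sup>2 * (real_of_int (poly_height F))\<^sup>2"
      by (intro mult_right_mono) (auto simp: power2_eq_square)
    finally show "(\<Sum>a\<leftarrow>coeffs F. (real_of_int a)\<^sup>2)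
        \<le> ((real D + 1) * real_of_int (poly_height F))\<^sup>2"
      by (simp add: power_mult_distrib)
  qed
  also have "\<dots> = (real D + 1) * real_of_int (poly_height F)"
    using H by simp
  finally show ?thesis .
qed

text \<open>Mignotte's bound for each coefficient, with the binomial coefficient estimated by
  \<open>2 ^ D\<close>.\<close>

lemma height_le_mahler_measure:
  assumes "degree F \<le> D"
  shows "real_of_int (poly_height F) \<le> 2 ^ D * mahler_measure F"
proof -
  obtain i where "poly_height F = \<bar>coeff F i\<bar>" using height_attained by blast
  then have "real_of_int (poly_height F) \<le> real (degree F choose i) * mahler_measure F"
    using Mignotte_bound[of F i] by simp
  also have "\<dots> \<le> 2 ^ D * mahler_measure F"
  proof (intro mult_right_mono mahler_measure_ge_0)
    have "degree F choose i \<le> 2 ^ D"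
      using binomial_le_pow2[of "degree F" i] assms
      by (meson order_trans power_increasing one_le_numeral)
    then have "real (degree F choose i) \<le> real (2 ^ D)"
      by (simp only: of_nat_le_iff)
    then show "real (degree F choose i) \<le> 2 ^ D" by simp
  qed
  finally show ?thesis .
qed

text \<open>Two factors \<open>2 ^ D\<close> come from Mignotte's bound for each of two polynomials,
  the factor \<open>D + 1\<close> from Landau's inequality for their product.\<close>

definition gelfond_const :: "nat \<Rightarrow> real" where
  "gelfond_const D = 4 ^ D * (real D + 1)"

lemma gelfond_const_ge_1: "gelfond_const D \<ge> 1"
proof -
  have "1 * 1 \<le> 4 ^ D * (real D + 1)" by (intro mult_mono) auto
  then show ?thesis by (simp add: gelfond_const_def)
qed

text \<open>Gelfond's inequality: the Mahler measure is multiplicative and comparable with the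
  height in both directions.\<close>

lemma gelfond_height_mult:
  assumes "A * B \<noteq> 0" "degree (A * B) \<le> D"
  shows "real_of_int (poly_height A) * real_of_int (poly_height B)
           \<le> gelfond_const D * real_of_int (poly_height (A * B))"
proof -
  have nz: "A \<noteq> 0" "B \<noteq> 0" using assms by auto
  then have deg: "degree A \<le> D" "degree B \<le> D"
    using assms by (auto simp: degree_mult_eq)
  have hom: "mahler_measure A * mahler_measure B = mahler_measure (A * B)"
    unfolding mahler_measure_def by (simp add: measure_eq_prod of_int_poly_hom.hom_mult)
  have "real_of_int (poly_height A) * real_of_int (poly_height B)
      \<le> (2 ^ D * mahler_measure A) * (2 ^ D * mahler_measure B)"
    using height_ge_1[OF nz(1)] height_ge_1[OF nz(2)]
    by (intro mult_mono height_le_mahler_measure deg) (auto simp: mahler_measure_ge_0)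
  also have "\<dots> = 4 ^ D * mahler_measure (A * B)"
  proof -
    have "(2::real) ^ D * 2 ^ D = 4 ^ D" by (simp flip: power_mult_distrib)
    then show ?thesis by (simp add: hom[symmetric] mult_ac)
  qed
  also have "\<dots> \<le> 4 ^ D * ((real D + 1) * real_of_int (poly_height (A * B)))"
    by (intro mult_left_mono mahler_measure_le_height assms) auto
  finally show ?thesis by (simp add: gelfond_const_def mult_ac)
qed

subsection \<open>Polynomials without common factor\<close>

text \<open>Constant common factors are allowed, so for nonzero polynomials this is coprimality over
  the rationals.\<close>

definition no_common_factor :: "int poly \<Rightarrow> int poly \<Rightarrow> bool" where
  "no_common_factor P Q \<longleftrightarrow> (\<forall>g. g dvd P \<longrightarrow> g dvd Q \<longrightarrow> degree g = 0)"

text \<open>The integer polynomials do not form a principal ideal domain. Instead, a nonzero element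
  \<open>r\<close> of least degree in the ideal of \<open>P\<close> and \<open>Q\<close> has a
  primitive part that divides both, so \<open>r\<close> is constant.\<close>

lemma no_common_factor_bezout:
  assumes "P \<noteq> 0" and ncf: "no_common_factor P Q"
  obtains a b c where "c \<noteq> 0" "a * P + b * Q = [:c:]"
proof -
  define S where "S = {r. r \<noteq> 0 \<and> (\<exists>a b. r = a * P + b * Q)}"
  have "P \<in> S" unfolding S_def using \<open>P \<noteq> 0\<close> by (auto intro: exI[of _ 1] exI[of _ 0])
  then obtain r where r: "r \<in> S" and least: "\<And>s. s \<in> S \<Longrightarrow> degree r \<le> degree s"
    using ex_has_least_nat[of "\<lambda>r. r \<in> S" P degree] by blast
  obtain a b where ab: "r = a * P + b * Q" and "r \<noteq> 0" using r unfolding S_def by auto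
  \<comment> \<open>The pseudo-remainder of an ideal element lies in the ideal and has smaller
    degree than \<open>r\<close> unless it is 0, so it is 0. Then \<open>r\<close> divides
    \<open>smult k F\<close>, and Gauss's lemma removes the constant \<open>k\<close>.\<close>
  have dvd: "primitive_part r dvd F" if F: "F = a1 * P + b1 * Q" for F a1 b1
  proof -
    obtain k q where kq: "k \<noteq> 0" "smult k F = r * q + pseudo_mod F r"
      using pseudo_mod(1)[OF \<open>r \<noteq> 0\<close>] by blast
    have "pseudo_mod F r = smult k F - r * q" using kq by simp
    also have "\<dots> = (smult k a1 - a * q) * P + (smult k b1 - b * q) * Q"
      unfolding F ab by (simp add: algebra_simps smult_add_right)
    finally have "pseudo_mod F r \<in> S" if "pseudo_mod F r \<noteq> 0"
      using that unfolding S_def by blast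
    with least pseudo_mod(2)[OF \<open>r \<noteq> 0\<close>, of F] have "pseudo_mod F r = 0"
      by fastforce
    with kq have "r dvd smult k F" by simp
    with kq(1) show ?thesis using dvd_smult_int by blast
  qed
  have "primitive_part r dvd P" "primitive_part r dvd Q"
    using dvd[of P 1 0] dvd[of Q 0 1] by simp_all
  then have "degree (primitive_part r) = 0"
    using ncf unfolding no_common_factor_def by blast
  then have "degree r = 0" by simp
  then obtain c where "r = [:c:]" by (rule degree_eq_zeroE)
  then show ?thesis using that[of c a b] ab \<open>r \<noteq> 0\<close> by auto
qed

text \<open>Pseudo-division of \<open>a\<close> by \<open>Q\<close> makes the first cofactor of
  degree below \<open>degree Q\<close>; the identity then controls the degree of
  \<open>b' * Q\<close>.\<close>

lemma no_common_factor_bezout_degree: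
  assumes "degree P \<ge> 1" "degree Q \<ge> 1" "degree P + degree Q \<le> N + 1"
    and ncf: "no_common_factor P Q"
  obtains a b c where "c \<noteq> 0" "a * P + b * Q = [:c:]"
    "degree a + degree P \<le> N" "degree b + degree Q \<le> N"
proof -
  have nz: "P \<noteq> 0" "Q \<noteq> 0" using assms by auto
  obtain a b c where abc: "c \<noteq> 0" "a * P + b * Q = [:c:]"
    using no_common_factor_bezout[OF nz(1) ncf] by blast
  obtain k q where kq: "k \<noteq> 0" "smult k a = Q * q + pseudo_mod a Q"
    using pseudo_mod(1)[OF nz(2)] by blast
  define a' where "a' = pseudo_mod a Q"
  define b' where "b' = smult k b + q * P"
  have eq: "a' * P + b' * Q = [:k * c:]"
  proof -
    have "a' = smult k a - Q * q" using kq by (simp add: a'_def)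
    then have "a' * P + b' * Q = (smult k a - Q * q) * P + b' * Q" by simp
    also have "\<dots> = smult k (a * P + b * Q)"
      unfolding b'_def by (simp add: algebra_simps smult_add_right smult_diff_right)
    finally show ?thesis using abc by simp
  qed
  \<comment> \<open>If the remainder \<open>a'\<close> is 0, the bound reads
    \<open>degree P \<le> N\<close> and follows from \<open>degree Q \<ge> 1\<close>.\<close>
  have dega: "degree a' + degree P \<le> N"
    using pseudo_mod(2)[OF nz(2), of a] assms by (auto simp: a'_def)
  have degb: "degree b' + degree Q \<le> N"
  proof (cases "b' = 0")
    case True
    then show ?thesis using assms by simp
  next
    case False
    have "b' * Q = [:k * c:] - a' * P" using eq by (simp add: algebra_simps)
    moreover have "degree ([:k * c:] - a' * P) \<le> N"
      using dega degree_mult_le[of a' P] by (intro degree_diff_le) auto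
    ultimately show ?thesis using False nz by (metis degree_mult_eq)
  qed
  show ?thesis using that[OF _ eq dega degb] abc kq by simp
qed

subsection \<open>The functional of a simultaneous approximation\<close>

definition dual_pairing :: "nat \<Rightarrow> (nat \<Rightarrow> int) \<Rightarrow> int poly \<Rightarrow> int" where
  "dual_pairing N y F = (\<Sum>i\<le>N. coeff F i * y i)"

lemma dual_pairing_add: "dual_pairing N y (F + G) = dual_pairing N y F + dual_pairing N y G"
  by (simp add: dual_pairing_def algebra_simps sum.distrib)

lemma dual_pairing_smult: "dual_pairing N y (smult c F) = c * dual_pairing N y F"
  by (simp add: dual_pairing_def algebra_simps sum_distrib_left)

lemma dual_pairing_const: "dual_pairing N y [:c:] = c * y 0"
proof -
  have "dual_pairing N y [:c:] = (\<Sum>i\<in>{0}. coeff [:c:] i * y i)"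
    unfolding dual_pairing_def by (intro sum.mono_neutral_right) (auto simp: coeff_pCons split: nat.split)
  then show ?thesis by simp
qed

lemma dual_pairing_sum:
  "finite I \<Longrightarrow> dual_pairing N y (\<Sum>j\<in>I. F j) = (\<Sum>j\<in>I. dual_pairing N y (F j))"
  by (induction I rule: finite_induct) (auto simp: dual_pairing_add, simp add: dual_pairing_def)

lemma dual_pairing_mult_eq_0:
  assumes "\<And>j. j \<le> degree a \<Longrightarrow> dual_pairing N y (monom 1 j * F) = 0"
  shows "dual_pairing N y (a * F) = 0"
proof -
  have "a * F = (\<Sum>j\<le>degree a. monom (coeff a j) j) * F"
    by (simp add: poly_as_sum_of_monoms)
  also have "\<dots> = (\<Sum>j\<le>degree a. smult (coeff a j) (monom 1 j * F))"
    by (simp add: sum_distrib_right smult_monom flip: mult_smult_left)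
  finally show ?thesis using assms by (simp add: dual_pairing_sum dual_pairing_smult)
qed

text \<open>With \<open>G\<close> the shift of \<open>F\<close> by \<open>j\<close>, the pairing
  equals \<open>y 0\<close> times the value of \<open>G\<close> at \<open>z\<close>, minus the sum
  of the coefficients of \<open>G\<close> times the approximation errors. It is an integer of
  modulus below 1. The power of \<open>max 1 \<bar>z\<bar>\<close> absorbs the shift.\<close>

lemma dual_pairing_monom_mult_eq_0:
  fixes y :: "nat \<Rightarrow> int"
  assumes deg: "j + degree F \<le> N"
    and x: "real_of_int \<bar>y 0\<bar> \<le> X"
    and approx: "\<And>i. i \<le> N \<Longrightarrow> \<bar>z ^ i * real_of_int (y 0) - real_of_int (y i)\<bar> \<le> d"
    and small: "max 1 \<bar>z\<bar> ^ N * X * \<bar>eval_at F z\<bar>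
                  + (real N + 1) * real_of_int (poly_height F) * d < 1"
  shows "dual_pairing N y (monom 1 j * F) = 0"
proof -
  define G where "G = monom 1 j * F"
  have degG: "degree G \<le> N"
    using deg degree_mult_le[of "monom 1 j" F] degree_monom_le[of "1::int" j] unfolding G_def by linarith
  have evG: "eval_at G z = z ^ j * eval_at F z"
    by (simp add: G_def eval_at_mult map_poly_monom poly_monom)
  have coeffG: "\<bar>coeff G i\<bar> \<le> poly_height F" for i
    using abs_coeff_le_height[of F "i - j"] abs_coeff_le_height[of F 0]
    by (auto simp: G_def coeff_monom_mult intro: order_trans[of 0 "\<bar>coeff F 0\<bar>"])
  have X: "0 \<le> X" using x by linarith
  have "real_of_int (dual_pairing N y G)
      = real_of_int (y 0) * eval_at G z
        - (\<Sum>i\<le>N. real_of_int (coeff G i) * (z ^ i * real_of_int (y 0) - real_of_int (y i)))"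
    by (simp add: dual_pairing_def eval_at_eq_sum[OF degG] sum_distrib_left algebra_simps sum_subtractf)
  then have "\<bar>real_of_int (dual_pairing N y G)\<bar>
      \<le> \<bar>real_of_int (y 0) * eval_at G z\<bar>
        + \<bar>\<Sum>i\<le>N. real_of_int (coeff G i) * (z ^ i * real_of_int (y 0) - real_of_int (y i))\<bar>"
    by linarith
  also have "\<bar>\<Sum>i\<le>N. real_of_int (coeff G i) * (z ^ i * real_of_int (y 0) - real_of_int (y i))\<bar>
      \<le> (\<Sum>i\<le>N. real_of_int (poly_height F) * d)"
  proof (intro order_trans[OF sum_abs] sum_mono)
    fix i assume "i \<in> {..N}"
    then have "\<bar>z ^ i * real_of_int (y 0) - real_of_int (y i)\<bar> \<le> d" using approx by simp
    moreover have "\<bar>real_of_int (coeff G i)\<bar> \<le> real_of_int (poly_height F)"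
      using coeffG[of i] by (metis of_int_abs of_int_le_iff)
    ultimately show "\<bar>real_of_int (coeff G i) * (z ^ i * real_of_int (y 0) - real_of_int (y i))\<bar>
        \<le> real_of_int (poly_height F) * d"
      unfolding abs_mult by (intro mult_mono) auto
  qed
  also have "\<dots> = (real N + 1) * real_of_int (poly_height F) * d" by simp
  also have "\<bar>real_of_int (y 0) * eval_at G z\<bar> \<le> max 1 \<bar>z\<bar> ^ N * X * \<bar>eval_at F z\<bar>"
  proof -
    have "\<bar>z\<bar> ^ j \<le> max 1 \<bar>z\<bar> ^ j" by (intro power_mono) auto
    also have "\<dots> \<le> max 1 \<bar>z\<bar> ^ N" using deg by (intro power_increasing) auto
    finally have "\<bar>z\<bar> ^ j * real_of_int \<bar>y 0\<bar> * \<bar>eval_at F z\<bar> \<le> max 1 \<bar>z\<bar> ^ N * X * \<bar>eval_at F z\<bar>"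
      using x X by (intro mult_mono) auto
    then show ?thesis by (simp add: evG abs_mult power_abs mult_ac)
  qed
  finally have "\<bar>real_of_int (dual_pairing N y G)\<bar> < 1" using small by linarith
  then show ?thesis unfolding G_def by linarith
qed

text \<open>The degree bounds on the Bezout cofactors keep every shift within degree
  \<open>N\<close>, so the functional kills both summands and hence the nonzero constant
  \<open>c\<close>; its value there is \<open>c * y 0\<close>.\<close>

lemma no_small_coprime_pair:
  fixes y :: "nat \<Rightarrow> int"
  assumes degs: "degree P \<ge> 1" "degree Q \<ge> 1" "degree P + degree Q \<le> N + 1"
    and ncf: "no_common_factor P Q"
    and x: "real_of_int \<bar>y 0\<bar> \<le> X"
    and approx: "\<And>i. i \<le> N \<Longrightarrow> \<bar>z ^ i * real_of_int (y 0) - real_of_int (y i)\<bar> \<le> d"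
    and small: "\<And>F. F \<in> {P, Q} \<Longrightarrow> max 1 \<bar>z\<bar> ^ N * X * \<bar>eval_at F z\<bar>
                  + (real N + 1) * real_of_int (poly_height F) * d < 1"
  shows "y 0 = 0"
proof -
  obtain a b c where abc: "c \<noteq> 0" "a * P + b * Q = [:c:]"
      "degree a + degree P \<le> N" "degree b + degree Q \<le> N"
    using no_common_factor_bezout_degree[OF degs ncf] by blast
  have "dual_pairing N y (a * P) = 0"
  proof (rule dual_pairing_mult_eq_0)
    fix j assume "j \<le> degree a"
    then have "j + degree P \<le> N" using abc by simp
    then show "dual_pairing N y (monom 1 j * P) = 0"
      using x approx small[of P] by (rule dual_pairing_monom_mult_eq_0) auto
  qed
  moreover have "dual_pairing N y (b * Q) = 0"
  proof (rule dual_pairing_mult_eq_0)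
    fix j assume "j \<le> degree b"
    then have "j + degree Q \<le> N" using abc by simp
    then show "dual_pairing N y (monom 1 j * Q) = 0"
      using x approx small[of Q] by (rule dual_pairing_monom_mult_eq_0) auto
  qed
  ultimately have "dual_pairing N y [:c:] = 0"
    by (simp add: abc(2)[symmetric] dual_pairing_add)
  with abc(1) show ?thesis by (simp add: dual_pairing_const)
qed

subsection \<open>Splitting off common factors\<close>

abbreviation ht :: "int poly \<Rightarrow> real" where
  "ht P \<equiv> real_of_int (poly_height P)"

lemma ht_ge_1: "P \<noteq> 0 \<Longrightarrow> ht P \<ge> 1"
  using height_ge_1[of P] by simp

lemma ht_nonneg: "ht P \<ge> 0"
  using abs_coeff_le_height[of P 0] by (simp add: order_trans[OF abs_ge_zero])

text \<open>Above the supremum only finitely many polynomials violate the bound with constant 1, and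
  \<open>c\<close> absorbs them. For \<open>k = 0\<close> the exponent is a convention, but nonzero
  integer constants have modulus at least 1.\<close>

lemma w_exp_lower_bound:
  assumes "\<not> algebraic z" "w_exp k z < ereal s" "0 \<le> s"
  obtains c where "0 < c"
    "\<And>A. A \<noteq> 0 \<Longrightarrow> degree A \<le> k \<Longrightarrow> c * ht A powr (- s) \<le> \<bar>eval_at A z\<bar>"
proof (cases "k = 0")
  case True
  show ?thesis
  proof (rule that[of 1])
    fix A :: "int poly" assume A: "A \<noteq> 0" "degree A \<le> k"
    have "ht A powr (- s) \<le> 1" using ht_ge_1[OF A(1)] \<open>0 \<le> s\<close>
      by (simp add: powr_minus inverse_le_1_iff ge_one_powr_ge_zero)
    then show "1 * ht A powr (- s) \<le> \<bar>eval_at A z\<bar>"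
      using abs_eval_at_const_ge_1[of A z] A True by simp
  qed simp
next
  case False
  define S where "S = {P :: int poly. degree P \<le> k \<and>
       0 < \<bar>eval_at P z\<bar> \<and> \<bar>eval_at P z\<bar> \<le> ht P powr (- s)}"
  have "finite S"
  proof (rule ccontr)
    assume "infinite S"
    then have "ereal s \<le> w_exp k z"
      using False unfolding w_exp_def S_def by (auto intro!: Sup_upper)
    with assms show False by simp
  qed
  \<comment> \<open>Inserting 1 gives \<open>c \<le> 1\<close>, needed for polynomials outside
    \<open>S\<close>, and covers the case of empty \<open>S\<close>.\<close>
  define c where "c = Min (insert 1 ((\<lambda>P. \<bar>eval_at P z\<bar>) ` S))"
  have "0 < c" unfolding c_def using \<open>finite S\<close> by (subst Min_gr_iff) (auto simp: S_def)
  moreover have "c * ht A powr (- s) \<le> \<bar>eval_at A z\<bar>" if A: "A \<noteq> 0" "degree A \<le> k" for A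
  proof (cases "A \<in> S")
    case True
    have "ht A powr (- s) \<le> 1" using ht_ge_1[OF A(1)] \<open>0 \<le> s\<close>
      by (simp add: powr_minus inverse_le_1_iff ge_one_powr_ge_zero)
    then have "c * ht A powr (- s) \<le> c * 1" using \<open>0 < c\<close> by (intro mult_left_mono) auto
    also have "c \<le> \<bar>eval_at A z\<bar>" unfolding c_def using \<open>finite S\<close> True by (intro Min_le) auto
    finally show ?thesis by simp
  next
    case False
    then have "ht A powr (- s) \<le> \<bar>eval_at A z\<bar>"
      using A eval_at_transcendental_nonzero[OF assms(1) A(1)] unfolding S_def by auto
    moreover have "c \<le> 1" unfolding c_def using \<open>finite S\<close> by (intro Min_le) auto
    then have "c * ht A powr (- s) \<le> 1 * ht A powr (- s)" by (intro mult_right_mono) auto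
    ultimately show ?thesis by simp
  qed
  ultimately show ?thesis using that by blast
qed

text \<open>Raising Gelfond's inequality to the power \<open>-s\<close> reverses it, which is the
  direction needed to multiply lower bounds.\<close>

lemma lower_bound_mult:
  assumes nz: "A * B \<noteq> 0" "degree (A * B) \<le> D" and "0 \<le> s" "0 < a" "0 < b"
    and A: "a * ht A powr (- s) \<le> \<bar>eval_at A z\<bar>"
    and B: "b * ht B powr (- s) \<le> \<bar>eval_at B z\<bar>"
  shows "a * b * gelfond_const D powr (- s) * ht (A * B) powr (- s) \<le> \<bar>eval_at (A * B) z\<bar>"
proof -
  have nz': "A \<noteq> 0" "B \<noteq> 0" using nz by auto
  have "(gelfond_const D * ht (A * B)) powr (- s) \<le> (ht A * ht B) powr (- s)"
  proof (rule powr_mono2')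
    show "0 < ht A * ht B" using ht_ge_1[OF nz'(1)] ht_ge_1[OF nz'(2)] by simp
  qed (use gelfond_height_mult[OF nz] \<open>0 \<le> s\<close> in auto)
  moreover have "0 \<le> gelfond_const D" using gelfond_const_ge_1[of D] by simp
  ultimately have "gelfond_const D powr (- s) * ht (A * B) powr (- s)
      \<le> ht A powr (- s) * ht B powr (- s)"
    using ht_nonneg by (simp add: powr_mult)
  then have "a * b * (gelfond_const D powr (- s) * ht (A * B) powr (- s))
      \<le> a * b * (ht A powr (- s) * ht B powr (- s))"
    using assms by (intro mult_left_mono) auto
  also have "\<dots> = (a * ht A powr (- s)) * (b * ht B powr (- s))" by simp
  also have "\<dots> \<le> \<bar>eval_at A z\<bar> * \<bar>eval_at B z\<bar>"
    using A B assms by (intro mult_mono) auto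
  finally show ?thesis by (simp add: eval_at_mult abs_mult mult_ac)
qed

definition splits_off :: "real \<Rightarrow> real \<Rightarrow> real \<Rightarrow> int poly \<Rightarrow> int poly \<Rightarrow> bool" where
  "splits_off z c v P Q \<longleftrightarrow>
     (\<exists>A B. Q = A * B \<and> no_common_factor P B \<and> c * ht A powr (- v) \<le> \<bar>eval_at A z\<bar>)"

text \<open>Induction on the degree bound: a nonconstant common factor \<open>g\<close> divides
  \<open>P\<close>, so \<open>lower\<close> applies to it, and the induction hypothesis treats the
  cofactor. Each step costs a constant factor, and the number of steps is bounded by the degree, so
  \<open>c\<close> is uniform in \<open>P\<close> and \<open>Q\<close>.\<close>

lemma common_factors_split_off:
  assumes lower: "\<And>A. A \<noteq> 0 \<Longrightarrow> degree A \<le> n \<Longrightarrow> c0 * ht A powr (- s) \<le> \<bar>eval_at A z\<bar>"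
    and "0 < c0" "0 \<le> s"
  shows "\<exists>c>0. \<forall>P Q. P \<noteq> 0 \<longrightarrow> degree P \<le> n \<longrightarrow> Q \<noteq> 0 \<longrightarrow> degree Q \<le> D \<longrightarrow> splits_off z c s P Q"
proof (induction D)
  case 0
  have "splits_off z 1 s P Q" if "Q \<noteq> 0" "degree Q \<le> 0" for P Q
    unfolding splits_off_def
  proof (intro exI conjI)
    show "no_common_factor P Q"
      using that unfolding no_common_factor_def by (metis dvd_imp_degree_le le_zero_eq)
  qed (auto simp: height_one)
  then show ?case by (intro exI[of _ 1]) auto
next
  case (Suc D)
  then obtain c1 where "c1 > 0" and c1: "\<And>P Q. P \<noteq> 0 \<Longrightarrow> degree P \<le> n \<Longrightarrow> Q \<noteq> 0 \<Longrightarrow>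
      degree Q \<le> D \<Longrightarrow> splits_off z c1 s P Q" by blast
  \<comment> \<open>The bound by 1 serves the trivial splitting \<open>A = 1\<close>, the other term
    the product \<open>g * A\<close>.\<close>
  define c where "c = min 1 (c0 * c1 * gelfond_const (Suc D) powr (- s))"
  have "0 < c"
    using gelfond_const_ge_1[of "Suc D"] \<open>c0 > 0\<close> \<open>c1 > 0\<close> by (simp add: c_def)
  moreover have "splits_off z c s P Q"
    if P: "P \<noteq> 0" "degree P \<le> n" and Q: "Q \<noteq> 0" "degree Q \<le> Suc D" for P Q
  proof (cases "no_common_factor P Q")
    case True
    then show ?thesis unfolding splits_off_def
      by (intro exI[of _ 1] exI[of _ Q]) (auto simp: height_one c_def)
  next
    case False
    then obtain g where g: "g dvd P" "g dvd Q" "degree g \<noteq> 0"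
      unfolding no_common_factor_def by blast
    then obtain Q' where Q': "Q = g * Q'" by blast
    have nz: "g \<noteq> 0" "Q' \<noteq> 0" using Q' Q by auto
    then have "degree Q' \<le> D" using Q Q' g(3) by (simp add: degree_mult_eq)
    then obtain A B where AB: "Q' = A * B" "no_common_factor P B"
        "c1 * ht A powr (- s) \<le> \<bar>eval_at A z\<bar>"
      using c1[OF P nz(2)] unfolding splits_off_def by blast
    have degg: "degree g \<le> n" using dvd_imp_degree_le[OF g(1) P(1)] P by simp
    have nzA: "g * A \<noteq> 0" using nz AB by auto
    have "degree (g * A) \<le> Suc D"
      using Q Q' AB nz by (intro order_trans[OF dvd_imp_degree_le[of "g * A" Q]]) auto
    then have "c0 * c1 * gelfond_const (Suc D) powr (- s) * ht (g * A) powr (- s)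
        \<le> \<bar>eval_at (g * A) z\<bar>"
      using lower_bound_mult[OF nzA _ \<open>0 \<le> s\<close> \<open>0 < c0\<close> \<open>0 < c1\<close> lower[OF nz(1) degg] AB(3)] by blast
    moreover have "c * ht (g * A) powr (- s)
        \<le> c0 * c1 * gelfond_const (Suc D) powr (- s) * ht (g * A) powr (- s)"
      by (intro mult_right_mono) (auto simp: c_def)
    ultimately have "c * ht (g * A) powr (- s) \<le> \<bar>eval_at (g * A) z\<bar>" by linarith
    then show ?thesis unfolding splits_off_def
      using Q' AB by (intro exI[of _ "g * A"] exI[of _ B]) (auto simp: mult_ac)
  qed
  ultimately show ?case by blast
qed

subsection \<open>Excluding good simultaneous approximations\<close>

lemma tendsto_const_mult_neg_powr:
  assumes "(a::real) < 0"
  shows "((\<lambda>X::real. K * X powr a) \<longlongrightarrow> 0) at_top"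
  using tendsto_mult[OF tendsto_const tendsto_neg_powr[OF assms filterlim_ident], of K] by simp

lemma filterlim_powr_at_top_pos:
  assumes "0 < (a::real)"
  shows "filterlim (\<lambda>X::real. X powr a) at_top at_top"
proof (rule filterlim_mono_eventually)
  show "filterlim (\<lambda>X::real. exp (a * ln X)) at_top at_top"
    by (intro filterlim_compose[OF exp_at_top] filterlim_tendsto_pos_mult_at_top[OF tendsto_const assms] ln_at_top)
  show "\<forall>\<^sub>F X::real in at_top. exp (a * ln X) = X powr a"
    using eventually_gt_at_top[of "0::real"] by eventually_elim (simp add: powr_def)
qed auto

text \<open>Here \<open>u\<close> and \<open>t\<close> are the orders of smallness of
  \<open>P\<close> and \<open>Q\<close>, and \<open>v\<close> is the loss from dividing
  \<open>Q\<close> by \<open>A\<close>. The remaining factor \<open>B\<close> is small of order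
  \<open>t - v\<close>, so \<open>P\<close> and \<open>B\<close> form a coprime pair to which
  \<open>no_small_coprime_pair\<close> applies.\<close>

lemma simultaneous_approx_impossible:
  assumes "n \<le> N + 1" "0 < l" "0 \<le> v" "0 < c"
    and lu: "1 < l * u" and lt: "1 < l * (t - v)"
    and evP: "\<forall>\<^sub>F X :: real in at_top. \<exists>P. degree P \<le> n \<and> ht P \<le> X \<and>
                0 < \<bar>eval_at P z\<bar> \<and> \<bar>eval_at P z\<bar> \<le> X powr (- u)"
    and evQ: "\<forall>\<^sub>F X :: real in at_top. \<exists>P. degree P \<le> N + 1 - n \<and> ht P \<le> X \<and>
                0 < \<bar>eval_at P z\<bar> \<and> \<bar>eval_at P z\<bar> \<le> X powr (- t)"
    and split: "\<forall>\<^sub>F X :: real in at_top. \<forall>P Q. P \<noteq> 0 \<longrightarrow> degree P \<le> n \<longrightarrow>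
                  Q \<noteq> 0 \<longrightarrow> degree Q \<le> N + 1 - n \<longrightarrow> ht Q \<le> X \<longrightarrow>
                  \<bar>eval_at Q z\<bar> \<le> X powr (- t) \<longrightarrow> splits_off z c v P Q"
  shows "\<forall>\<^sub>F X :: real in at_top. \<not> (\<exists>(x :: int) (y :: nat \<Rightarrow> int).
           1 \<le> \<bar>x\<bar> \<and> real_of_int \<bar>x\<bar> \<le> X \<and>
           (\<forall>i\<in>{1..N}. \<bar>z ^ i * real_of_int x - real_of_int (y i)\<bar> \<le> X powr (- l)))"
proof -
  have u: "0 < u" using lu \<open>0 < l\<close> by (smt (verit) mult_nonneg_nonpos)
  have tv: "0 < t - v" using lt \<open>0 < l\<close> by (smt (verit) mult_nonneg_nonpos)
  have "max (1 / u) (1 / (t - v)) < l" using u tv lu lt by (simp add: field_simps)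
  \<comment> \<open>The height bound will be \<open>X powr m\<close>. The two lower bounds on
    \<open>m\<close> make \<open>X\<close> times the values of \<open>P\<close> and \<open>B\<close>
    tend to 0, and \<open>m < l\<close> makes the heights times the approximation error tend to
    0.\<close>
  then obtain m where m: "1 / u < m" "1 / (t - v) < m" "m < l"
    using dense by (metis max_less_iff_conj)
  have "0 < m" using m(1) u by (smt (verit) divide_pos_pos)
  have mu: "1 - m * u < 0" using m(1) u by (simp add: field_simps)
  have mt: "1 - m * (t - v) < 0" using m(2) tv by (simp add: field_simps)
  define Z where "Z = max 1 \<bar>z\<bar> ^ N"
  define C where "C = gelfond_const (N + 1 - n)"
  have Z1: "1 \<le> Z" unfolding Z_def by (intro one_le_power) auto
  have C1: "1 \<le> C" unfolding C_def by (rule gelfond_const_ge_1)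
  have ev1: "\<forall>\<^sub>F X in at_top. Z * X powr (1 - m * u) + (real N + 1) * X powr (m - l) < 1"
    using tendsto_add[OF tendsto_const_mult_neg_powr[OF mu, of Z]
        tendsto_const_mult_neg_powr[of "m - l" "real N + 1"]] m(3)
    by (intro order_tendstoD) auto
  \<comment> \<open>Passing from \<open>Q\<close> to \<open>B\<close> costs the factor
    \<open>C powr v / c\<close> in the value and \<open>C\<close> in the height.\<close>
  have ev2: "\<forall>\<^sub>F X in at_top. (Z * (C powr v / c)) * X powr (1 - m * (t - v))
               + ((real N + 1) * C) * X powr (m - l) < 1"
    using tendsto_add[OF tendsto_const_mult_neg_powr[OF mt, of "Z * (C powr v / c)"]
        tendsto_const_mult_neg_powr[of "m - l" "(real N + 1) * C"]] m(3)
    by (intro order_tendstoD) auto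
  note lim = filterlim_powr_at_top_pos[OF \<open>0 < m\<close>]
  show ?thesis
    using ev1 ev2 eventually_compose_filterlim[OF evP lim] eventually_compose_filterlim[OF evQ lim]
      eventually_compose_filterlim[OF split lim] eventually_ge_at_top[of "1::real"]
  proof eventually_elim
    case (elim X)
    define Y where "Y = X powr m"
    define d where "d = X powr (- l)"
    have X: "1 \<le> X" by fact
    have Y: "0 < Y" using X by (simp add: Y_def)
    have d: "0 \<le> d" by (simp add: d_def)
    have XY: "X * Y powr a = X powr (1 + m * a)" for a
      using X by (simp add: Y_def powr_powr powr_add)
    have Yd: "Y * d = X powr (m - l)"
      by (simp add: Y_def d_def flip: powr_add)
    obtain P where P: "degree P \<le> n" "ht P \<le> Y" "0 < \<bar>eval_at P z\<bar>" "\<bar>eval_at P z\<bar> \<le> Y powr (- u)"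
      using elim(3) unfolding Y_def by blast
    obtain Q where Q: "degree Q \<le> N + 1 - n" "ht Q \<le> Y" "0 < \<bar>eval_at Q z\<bar>"
        "\<bar>eval_at Q z\<bar> \<le> Y powr (- t)"
      using elim(4) unfolding Y_def by blast
    have nz: "P \<noteq> 0" "Q \<noteq> 0" using P Q by auto
    have "splits_off z c v P Q" using elim(5) nz P Q unfolding Y_def by blast
    then obtain A B where AB: "Q = A * B" "no_common_factor P B"
        "c * ht A powr (- v) \<le> \<bar>eval_at A z\<bar>"
      unfolding splits_off_def by blast
    have nzAB: "A \<noteq> 0" "B \<noteq> 0" using AB(1) nz by auto
    have smallP: "Z * X * \<bar>eval_at P z\<bar> + (real N + 1) * ht P * d < 1"
    proof -
      have "Z * X * \<bar>eval_at P z\<bar> \<le> Z * X * Y powr (- u)"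
        using P(4) X Z1 by (intro mult_left_mono) auto
      also have "\<dots> = Z * X powr (1 - m * u)" using XY[of "- u"] by (simp add: mult.assoc)
      finally have 1: "Z * X * \<bar>eval_at P z\<bar> \<le> Z * X powr (1 - m * u)" .
      have "(real N + 1) * ht P * d \<le> (real N + 1) * Y * d"
        using P(2) d by (intro mult_right_mono mult_left_mono) auto
      also have "\<dots> = (real N + 1) * X powr (m - l)" using Yd by (simp add: mult.assoc)
      finally show ?thesis using 1 elim(1) by linarith
    qed
    have AB_le: "ht A * ht B \<le> C * Y"
    proof -
      have "ht A * ht B \<le> C * ht (A * B)"
        unfolding C_def using AB(1) nz Q by (intro gelfond_height_mult) auto
      also have "\<dots> \<le> C * Y" using Q(2) AB(1) C1 by (intro mult_left_mono) auto
      finally show ?thesis .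
    qed
    have htA: "1 \<le> ht A" and htB: "1 \<le> ht B" using nzAB ht_ge_1 by auto
    have "ht A * 1 \<le> ht A * ht B" using htA htB by (intro mult_left_mono) auto
    with AB_le have A_le: "ht A \<le> C * Y" by linarith
    have "1 * ht B \<le> ht A * ht B" using htA htB by (intro mult_right_mono) auto
    with AB_le have B_le: "ht B \<le> C * Y" by linarith
    have evalB: "\<bar>eval_at B z\<bar> \<le> C powr v / c * Y powr (v - t)"
    proof -
      have pos: "0 < c * ht A powr (- v)" using \<open>0 < c\<close> htA by simp
      have "\<bar>eval_at B z\<bar> * (c * ht A powr (- v)) \<le> \<bar>eval_at B z\<bar> * \<bar>eval_at A z\<bar>"
        using AB(3) by (intro mult_left_mono) auto
      also have "\<dots> = \<bar>eval_at Q z\<bar>" by (simp add: AB(1) eval_at_mult abs_mult mult_ac)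
      also have "\<dots> \<le> Y powr (- t)" by (rule Q(4))
      finally have "\<bar>eval_at B z\<bar> \<le> Y powr (- t) / (c * ht A powr (- v))"
        using pos by (simp add: pos_le_divide_eq)
      also have "\<dots> = Y powr (- t) * ht A powr v / c"
        using htA by (simp add: powr_minus field_simps)
      also have "\<dots> \<le> Y powr (- t) * (C * Y) powr v / c"
        using A_le htA \<open>0 \<le> v\<close> \<open>0 < c\<close>
        by (intro divide_right_mono mult_left_mono powr_mono2) auto
      also have "\<dots> = C powr v / c * Y powr (v - t)"
        using Y C1 by (simp add: powr_mult powr_diff powr_minus field_simps)
      finally show ?thesis .
    qed
    have smallB: "Z * X * \<bar>eval_at B z\<bar> + (real N + 1) * ht B * d < 1"
    proof -
      have "Z * X * \<bar>eval_at B z\<bar> \<le> Z * X * (C powr v / c * Y powr (v - t))"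
        using evalB X Z1 by (intro mult_left_mono) auto
      also have "\<dots> = Z * (C powr v / c) * (X * Y powr (v - t))" by simp
      also have "\<dots> = Z * (C powr v / c) * X powr (1 - m * (t - v))"
        unfolding XY by (simp add: algebra_simps)
      finally have 1: "Z * X * \<bar>eval_at B z\<bar> \<le> Z * (C powr v / c) * X powr (1 - m * (t - v))" .
      have "(real N + 1) * ht B * d \<le> (real N + 1) * (C * Y) * d"
        using B_le d by (intro mult_right_mono mult_left_mono) auto
      also have "\<dots> = (real N + 1) * C * X powr (m - l)" by (simp add: Yd[symmetric])
      finally show ?thesis using 1 elim(2) by linarith
    qed
    \<comment> \<open>A nonzero integer constant has modulus at least 1, and \<open>Z\<close> and
      \<open>X\<close> are at least 1, so it cannot be small in this sense.\<close>
    have nonconst: "degree F \<ge> 1"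
      if "F \<noteq> 0" and small: "Z * X * \<bar>eval_at F z\<bar> + (real N + 1) * ht F * d < 1" for F
    proof (rule ccontr)
      assume "\<not> 1 \<le> degree F"
      then have "1 \<le> \<bar>eval_at F z\<bar>" using abs_eval_at_const_ge_1[of F z] that by simp
      then have "1 * 1 * 1 \<le> Z * X * \<bar>eval_at F z\<bar>"
        using Z1 X by (intro mult_mono) auto
      moreover have "0 \<le> (real N + 1) * ht F * d" using d ht_nonneg by simp
      ultimately show False using small by linarith
    qed
    show ?case
    proof (intro notI, elim exE conjE)
      fix x :: int and y :: "nat \<Rightarrow> int"
      assume x: "1 \<le> \<bar>x\<bar>" "real_of_int \<bar>x\<bar> \<le> X"
        and y: "\<forall>i\<in>{1..N}. \<bar>z ^ i * real_of_int x - real_of_int (y i)\<bar> \<le> X powr (- l)"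
      \<comment> \<open>The integer \<open>x\<close> becomes the entry at index 0, where the
        approximation error vanishes.\<close>
      define y' where "y' = y(0 := x)"
      have "y' 0 = 0"
      proof (rule no_small_coprime_pair)
        show "degree P \<ge> 1" using nonconst[OF nz(1) smallP] .
        show "degree B \<ge> 1" using nonconst[OF nzAB(2) smallB] .
        have "degree B \<le> degree Q" using AB(1) nz by (intro dvd_imp_degree_le) auto
        then show "degree P + degree B \<le> N + 1" using P(1) Q(1) \<open>n \<le> N + 1\<close> by linarith
        show "no_common_factor P B" by (rule AB(2))
        show "real_of_int \<bar>y' 0\<bar> \<le> X" using x by (simp add: y'_def)
        show "\<bar>z ^ i * real_of_int (y' 0) - real_of_int (y' i)\<bar> \<le> d" if "i \<le> N" for i
          using y that d by (cases "i = 0") (auto simp: y'_def d_def)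
        show "max 1 \<bar>z\<bar> ^ N * X * \<bar>eval_at F z\<bar> + (real N + 1) * ht F * d < 1"
          if "F \<in> {P, B}" for F
          using that smallP smallB unfolding Z_def by auto
      qed
      then show False using x by (simp add: y'_def)
    qed
  qed
qed

subsection \<open>Dirichlet's theorem and elementary properties of the exponents\<close>

text \<open>Pigeonhole: the \<open>(K + 1) ^ (m + 1)\<close> coefficient vectors with entries in
  \<open>{0..K}\<close> take values in an interval of length \<open>2 * C * K\<close>, cut into
  \<open>K ^ (m + 1)\<close> boxes. Two vectors sharing a box differ by the desired
  polynomial.\<close>

lemma dirichlet_small_polynomial:
  fixes z :: real
  assumes "K \<ge> 1"
  shows "\<exists>P. P \<noteq> 0 \<and> degree P \<le> m \<and> poly_height P \<le> int K \<and>
           \<bar>eval_at P z\<bar> \<le> 2 * (real (m + 1) * max 1 \<bar>z\<bar> ^ m + 1) * real K powr (- real m)"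
proof -
  \<comment> \<open>The summand 1 makes the bound \<open>\<bar>V f\<bar> < C * K\<close> strict, so
    that \<open>box f\<close> stays below \<open>M\<close>.\<close>
  define C where "C = real (m + 1) * max 1 \<bar>z\<bar> ^ m + 1"
  define M where "M = K ^ (m + 1)"
  define S where "S = PiE {..m} (\<lambda>_. {0..K})"
  define V where "V f = (\<Sum>i\<le>m. real (f i) * z ^ i)" for f :: "nat \<Rightarrow> nat"
  define box where "box f = nat \<lfloor>(V f + C * K) / (2 * C * K) * M\<rfloor>" for f
  have C: "0 < C" by (simp add: C_def add_nonneg_pos)
  have K: "0 < real K" using assms by simp
  have M: "0 < real M" using assms by (simp add: M_def)
  have V: "\<bar>V f\<bar> < C * K" if "f \<in> S" for f
  proof -
    have "\<bar>V f\<bar> \<le> (\<Sum>i\<le>m. real K * max 1 \<bar>z\<bar> ^ m)"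
      unfolding V_def
    proof (intro order_trans[OF sum_abs] sum_mono)
      fix i assume i: "i \<in> {..m}"
      have "\<bar>z\<bar> ^ i \<le> max 1 \<bar>z\<bar> ^ i" by (intro power_mono) auto
      also have "\<dots> \<le> max 1 \<bar>z\<bar> ^ m" using i by (intro power_increasing) auto
      finally have "\<bar>z\<bar> ^ i \<le> max 1 \<bar>z\<bar> ^ m" .
      moreover have "f i \<le> K" using that i unfolding S_def by (auto simp: PiE_iff)
      ultimately show "\<bar>real (f i) * z ^ i\<bar> \<le> real K * max 1 \<bar>z\<bar> ^ m"
        by (auto simp: abs_mult power_abs intro!: mult_mono)
    qed
    also have "\<dots> < C * K" using K by (simp add: C_def algebra_simps)
    finally show ?thesis .
  qed
  have box: "box f < M" "real (box f) \<le> (V f + C * K) / (2 * C * K) * M"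
      "(V f + C * K) / (2 * C * K) * M < real (box f) + 1" if "f \<in> S" for f
  proof -
    define q where "q = (V f + C * K) / (2 * C * K) * M"
    have pos: "0 < 2 * C * K" using C K by simp
    have bounds: "0 \<le> V f + C * K" "V f + C * K < 2 * C * K" using V[OF that] by linarith+
    then have "0 \<le> q" using pos M by (simp add: q_def)
    moreover have "q < 1 * real M"
      unfolding q_def using bounds pos M by (intro mult_strict_right_mono) (simp_all add: divide_less_eq)
    ultimately show "box f < M" "real (box f) \<le> (V f + C * K) / (2 * C * K) * M"
      "(V f + C * K) / (2 * C * K) * M < real (box f) + 1"
      unfolding box_def q_def[symmetric] by linarith+
  qed
  have "card (box ` S) \<le> card {..<M}" using box(1) by (intro card_mono) auto
  also have "\<dots> < (K + 1) ^ (m + 1)"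
    unfolding M_def by (simp only: card_lessThan) (intro power_strict_mono; simp)
  also have "\<dots> = card S" by (simp add: S_def card_PiE)
  finally have "\<not> inj_on box S" by (rule pigeonhole)
  then obtain f g where fg: "f \<in> S" "g \<in> S" "f \<noteq> g" "box f = box g"
    unfolding inj_on_def by blast
  define P where "P = (\<Sum>i\<le>m. monom (int (f i) - int (g i)) i)"
  have coeffP: "coeff P i = (if i \<le> m then int (f i) - int (g i) else 0)" for i
    by (auto simp: P_def coeff_sum coeff_monom sum.delta)
  have degP: "degree P \<le> m" by (intro degree_le) (auto simp: coeffP)
  have "\<exists>i\<le>m. f i \<noteq> g i"
    using fg unfolding S_def by (metis PiE_ext atMost_iff)
  then have nz: "P \<noteq> 0" by (metis coeffP coeff_0 eq_iff_diff_eq_0 of_nat_eq_iff)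
  have le: "f i \<le> K" "g i \<le> K" if "i \<le> m" for i
    using fg that unfolding S_def by (auto simp: PiE_iff)
  have height: "poly_height P \<le> int K"
  proof (rule height_leI)
    show "\<bar>coeff P i\<bar> \<le> int K" for i
      using le[of i] by (cases "i \<le> m") (simp_all add: coeffP abs_le_iff)
  qed
  have "eval_at P z = V f - V g"
    by (simp add: eval_at_eq_sum[OF degP] coeffP V_def sum_subtractf algebra_simps)
  moreover have "\<bar>V f - V g\<bar> \<le> 2 * C * real K powr (- real m)"
  proof -
    have "\<bar>(V f + C * K) / (2 * C * K) * M - (V g + C * K) / (2 * C * K) * M\<bar> < 1"
      using box(2,3)[OF fg(1)] box(2,3)[OF fg(2)] fg(4) by linarith
    also have "(V f + C * K) / (2 * C * K) * M - (V g + C * K) / (2 * C * K) * M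
        = (V f - V g) * (M / (2 * C * K))"
      by (simp add: add_divide_distrib diff_divide_distrib ring_distribs)
    finally have "\<bar>V f - V g\<bar> * (M / (2 * C * K)) < 1"
      using C K M by (simp add: abs_mult)
    then have "\<bar>V f - V g\<bar> < 2 * C * K / M" using C K M by (simp add: field_simps)
    also have "\<dots> = 2 * C * real K powr (- real m)"
      using K by (simp add: M_def powr_minus powr_realpow field_simps)
    finally show ?thesis by simp
  qed
  ultimately show ?thesis using nz degP height unfolding C_def by auto
qed

text \<open>Dirichlet's theorem loses a constant, so each exponent \<open>r < m\<close> is reached
  separately; the values are nonzero by transcendence.\<close>

lemma w_hat_exp_ge:
  assumes "\<not> algebraic z"
  shows "ereal (real m) \<le> w_hat_exp m z"
proof (rule dense_le)
  fix w assume "w < ereal (real m)"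
  show "w \<le> w_hat_exp m z"
  proof (cases w)
    case (real r)
    then have r: "r < real m" using \<open>w < ereal (real m)\<close> by simp
    define D where "D = 2 * (real (m + 1) * max 1 \<bar>z\<bar> ^ m + 1)"
    have D: "0 < D" by (simp add: D_def add_nonneg_pos)
    have "\<forall>\<^sub>F X in at_top. (D * 2 powr real m) * X powr (r - real m) < 1"
      using tendsto_const_mult_neg_powr[of "r - real m" "D * 2 powr real m"] r
      by (intro order_tendstoD) auto
    then have "\<forall>\<^sub>F X in at_top. \<exists>P :: int poly. degree P \<le> m \<and> ht P \<le> X \<and>
       0 < \<bar>eval_at P z\<bar> \<and> \<bar>eval_at P z\<bar> \<le> X powr (- r)"
      using eventually_ge_at_top[of "1::real"]
    proof eventually_elim
      case (elim X)
      \<comment> \<open>Rounding \<open>X\<close> down at most halves it, which accounts for the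
        factor \<open>2 powr real m\<close> above.\<close>
      define K where "K = nat \<lfloor>X\<rfloor>"
      have "K \<ge> 1" "real K \<le> X" "X - 1 \<le> real K" using \<open>1 \<le> X\<close> unfolding K_def by linarith+
      then have K: "K \<ge> 1" "real K \<le> X" "X / 2 \<le> real K" by linarith+
      obtain P where P: "P \<noteq> 0" "degree P \<le> m" "poly_height P \<le> int K"
          "\<bar>eval_at P z\<bar> \<le> D * real K powr (- real m)"
        using dirichlet_small_polynomial[OF K(1), of m z] unfolding D_def by blast
      note P(4)
      also have "D * real K powr (- real m) \<le> D * (X / 2) powr (- real m)"
        using K \<open>1 \<le> X\<close> D by (intro mult_left_mono powr_mono2') auto
      also have "\<dots> = (D * 2 powr real m * X powr (r - real m)) * X powr (- r)"
        using \<open>1 \<le> X\<close> by (simp add: powr_divide powr_minus powr_diff field_simps)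
      also have "\<dots> \<le> 1 * X powr (- r)"
        using elim(1) by (intro mult_right_mono) auto
      finally have "\<bar>eval_at P z\<bar> \<le> X powr (- r)" by simp
      moreover have "ht P \<le> X" using P(3) K(2) by linarith
      ultimately show ?case
        using P(1,2) eval_at_transcendental_nonzero[OF assms P(1)] by auto
    qed
    then show ?thesis unfolding w_hat_exp_def real by (intro Sup_upper) auto
  qed (use \<open>w < ereal (real m)\<close> in auto)
qed

text \<open>For positive \<open>n\<close>, the linear polynomials with leading coefficient
  \<open>Suc q\<close> whose values are fractional parts reach the exponent 0.\<close>

lemma w_exp_nonneg:
  assumes "\<not> algebraic z"
  shows "0 \<le> w_exp n z"
proof (cases "n = 0")
  case True
  then show ?thesis by (simp add: w_exp_def)
next
  case False
  define F :: "nat \<Rightarrow> int poly" where "F q = [:- \<lfloor>real (Suc q) * z\<rfloor>, int (Suc q):]" for q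
  have "inj F" by (rule injI) (simp add: F_def)
  then have inf: "infinite (range F)" by (rule range_inj_infinite)
  have "range F \<subseteq> {P. degree P \<le> n \<and> 0 < \<bar>eval_at P z\<bar> \<and> \<bar>eval_at P z\<bar> \<le> ht P powr (- 0)}"
  proof safe
    fix q
    have nz: "F q \<noteq> 0" by (simp add: F_def)
    show "degree (F q) \<le> n" using False by (simp add: F_def)
    show "0 < \<bar>eval_at (F q) z\<bar>" using eval_at_transcendental_nonzero[OF assms nz] by simp
    have "eval_at (F q) z = real (Suc q) * z - \<lfloor>real (Suc q) * z\<rfloor>"
      by (simp add: F_def map_poly_pCons algebra_simps)
    then have "\<bar>eval_at (F q) z\<bar> \<le> 1" by linarith
    then show "\<bar>eval_at (F q) z\<bar> \<le> ht (F q) powr (- 0)" using ht_ge_1[OF nz] by simp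
  qed
  with inf have "infinite {P. degree P \<le> n \<and> 0 < \<bar>eval_at P z\<bar> \<and> \<bar>eval_at P z\<bar> \<le> ht P powr (- 0)}"
    using finite_subset by blast
  then have "ereal 0 \<le> w_exp n z"
    using False unfolding w_exp_def by (auto intro!: Sup_upper)
  then show ?thesis by (simp add: zero_ereal_def)
qed

lemma w_exp_mono:
  assumes "\<not> algebraic z" "k \<le> n"
  shows "w_exp k z \<le> w_exp n z"
proof (cases "k = 0")
  case True
  then show ?thesis using w_exp_nonneg[OF assms(1), of n] by (simp add: w_exp_def)
next
  case False
  then have "n \<noteq> 0" using assms by simp
  have "infinite {P. degree P \<le> n \<and> 0 < \<bar>eval_at P z\<bar> \<and> \<bar>eval_at P z\<bar> \<le> ht P powr (- w)}"
    if "infinite {P. degree P \<le> k \<and> 0 < \<bar>eval_at P z\<bar> \<and> \<bar>eval_at P z\<bar> \<le> ht P powr (- w)}" for w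
    using that by (rule infinite_super[rotated]) (use assms in auto)
  then show ?thesis
    using False \<open>n \<noteq> 0\<close> unfolding w_exp_def by (auto intro!: Sup_subset_mono)
qed

subsection \<open>Comparing the exponents\<close>

text \<open>The value 0 of \<open>w\<close> is excluded since then \<open>1 / w\<close> is infinite;
  an infinite \<open>w\<close> gives \<open>1 / w = 0\<close>.\<close>

lemma ereal_inverse_lessD:
  assumes "0 \<le> w" "1 / w < ereal l"
  shows "0 < l" "ereal (1 / l) < w"
proof -
  have "0 < l \<and> ereal (1 / l) < w"
  proof (cases w)
    case (real r)
    show ?thesis
    proof (cases "r = 0")
      case True
      then show ?thesis using assms real by (simp add: divide_ereal_def)
    next
      case False
      then have "0 < r" using assms real by simp
      then have "1 / r < l" using assms real by (simp add: one_ereal_def)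
      moreover have "0 < 1 / r" using \<open>0 < r\<close> by simp
      ultimately have "0 < l" by linarith
      with \<open>1 / r < l\<close> \<open>0 < r\<close> show ?thesis by (simp add: real field_simps)
    qed
  qed (use assms in auto)
  then show "0 < l" "ereal (1 / l) < w" by auto
qed

text \<open>Common frame of both bounds: \<open>r\<close> is the exponent lost in the splitting, and
  \<open>q\<close> is a threshold such that splitting is only required for \<open>Q\<close> of order
  of smallness \<open>t > q\<close>. An approximation exponent \<open>l\<close> above the maximum
  leaves room for suitable \<open>t\<close>, \<open>u\<close> and \<open>v\<close>.\<close>

lemma lambda_exp_le_max:
  assumes "\<not> algebraic z" "n \<le> N + 1" "0 \<le> r"
    and r: "ereal r \<le> w_hat_exp (N + 1 - n) z"
    and q: "ereal q < w_hat_exp (N + 1 - n) z"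
    and split: "\<And>t v. q < t \<Longrightarrow> r < v \<Longrightarrow> \<exists>c>0. \<forall>\<^sub>F X :: real in at_top.
                  \<forall>P Q. P \<noteq> 0 \<longrightarrow> degree P \<le> n \<longrightarrow> Q \<noteq> 0 \<longrightarrow> degree Q \<le> N + 1 - n \<longrightarrow> ht Q \<le> X \<longrightarrow>
                  \<bar>eval_at Q z\<bar> \<le> X powr (- t) \<longrightarrow> splits_off z c v P Q"
  shows "lambda_exp N z \<le> max (1 / w_hat_exp n z) (1 / (w_hat_exp (N + 1 - n) z - ereal r))"
proof (rule ccontr)
  assume "\<not> ?thesis"
  then have "max (1 / w_hat_exp n z) (1 / (w_hat_exp (N + 1 - n) z - ereal r)) < lambda_exp N z"
    by (simp only: not_le)
  then obtain l where l1: "1 / w_hat_exp n z < ereal l"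
    and l2: "1 / (w_hat_exp (N + 1 - n) z - ereal r) < ereal l"
    and freq: "\<exists>\<^sub>F X :: real in at_top. \<exists>(x :: int) (y :: nat \<Rightarrow> int).
       1 \<le> \<bar>x\<bar> \<and> real_of_int \<bar>x\<bar> \<le> X \<and>
       (\<forall>i\<in>{1..N}. \<bar>z ^ i * real_of_int x - real_of_int (y i)\<bar> \<le> X powr (- l))"
    unfolding lambda_exp_def less_Sup_iff by auto
  have "0 \<le> w_hat_exp n z"
    using w_hat_exp_ge[OF assms(1), of n] by (rule order_trans[rotated]) simp
  note lu = ereal_inverse_lessD[OF this l1]
  have "0 \<le> w_hat_exp (N + 1 - n) z - ereal r"
    using r by (simp add: ereal_diff_positive)
  note lt = ereal_inverse_lessD[OF this l2]
  have "ereal (max q (r + 1 / l)) < w_hat_exp (N + 1 - n) z"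
    using q lt(2) by (cases "w_hat_exp (N + 1 - n) z") (auto simp: max_def)
  then obtain t where t: "q < t" "r + 1 / l < t"
    and evQ: "\<forall>\<^sub>F X :: real in at_top. \<exists>P. degree P \<le> N + 1 - n \<and> ht P \<le> X \<and>
                0 < \<bar>eval_at P z\<bar> \<and> \<bar>eval_at P z\<bar> \<le> X powr (- t)"
    unfolding w_hat_exp_def less_Sup_iff by auto
  obtain u where u: "1 / l < u"
    and evP: "\<forall>\<^sub>F X :: real in at_top. \<exists>P. degree P \<le> n \<and> ht P \<le> X \<and>
                0 < \<bar>eval_at P z\<bar> \<and> \<bar>eval_at P z\<bar> \<le> X powr (- u)"
    using lu(2) unfolding w_hat_exp_def less_Sup_iff by auto
  \<comment> \<open>\<open>v\<close> must exceed \<open>r\<close> for the splitting and stay below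
    \<open>t - 1 / l\<close> for \<open>1 < l * (t - v)\<close>.\<close>
  obtain v where v: "r < v" "v < t - 1 / l"
    using t(2) dense[of r "t - 1 / l"] by auto
  obtain c where "0 < c" and ev: "\<forall>\<^sub>F X :: real in at_top.
                  \<forall>P Q. P \<noteq> 0 \<longrightarrow> degree P \<le> n \<longrightarrow> Q \<noteq> 0 \<longrightarrow> degree Q \<le> N + 1 - n \<longrightarrow> ht Q \<le> X \<longrightarrow>
                  \<bar>eval_at Q z\<bar> \<le> X powr (- t) \<longrightarrow> splits_off z c v P Q"
    using split[OF t(1) v(1)] by blast
  have "1 / l < t - v" using v(2) by simp
  then have "1 < l * u" "1 < l * (t - v)" 
    using u by (simp_all add: pos_divide_less_eq[OF lu(1)] mult.commute)
  moreover have "0 \<le> v" using v \<open>0 \<le> r\<close> by simp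
  ultimately have "\<forall>\<^sub>F X :: real in at_top. \<not> (\<exists>(x :: int) (y :: nat \<Rightarrow> int).
           1 \<le> \<bar>x\<bar> \<and> real_of_int \<bar>x\<bar> \<le> X \<and>
           (\<forall>i\<in>{1..N}. \<bar>z ^ i * real_of_int x - real_of_int (y i)\<bar> \<le> X powr (- l)))"
    by (intro simultaneous_approx_impossible[OF assms(2) lu(1) _ \<open>0 < c\<close> _ _ evP evQ ev])
  with freq show False by (simp add: frequently_def)
qed

lemma split_off_w_exp:
  assumes "\<not> algebraic z" "w_exp n z < ereal v" "0 \<le> v"
  shows "\<exists>c>0. \<forall>P Q. P \<noteq> 0 \<longrightarrow> degree P \<le> n \<longrightarrow> Q \<noteq> 0 \<longrightarrow> degree Q \<le> D \<longrightarrow> splits_off z c v P Q"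
proof -
  obtain c0 where "0 < c0"
      "\<And>A. A \<noteq> 0 \<Longrightarrow> degree A \<le> n \<Longrightarrow> c0 * ht A powr (- v) \<le> \<bar>eval_at A z\<bar>"
    using w_exp_lower_bound[OF assms] by blast
  then show ?thesis using common_factors_split_off[of n c0 v z] \<open>0 \<le> v\<close> by blast
qed

text \<open>Split first with the exponent \<open>s\<close>. If \<open>degree A > k\<close>, then
  \<open>degree B \<le> n\<close>, so both factors obey lower bounds with \<open>s\<close>, and
  their product contradicts the smallness of \<open>Q\<close> for large \<open>X\<close> because
  \<open>s < t\<close>. So \<open>degree A \<le> k\<close>, and the better exponent \<open>v\<close>
  applies to \<open>A\<close>.\<close>

lemma split_off_low_degree:
  assumes "\<not> algebraic z" "w_exp n z < ereal s" "0 \<le> s" "s < t"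
    and "w_exp k z < ereal v" "0 \<le> v" and D: "D \<le> n + k + 1"
  shows "\<exists>c>0. \<forall>\<^sub>F X :: real in at_top. \<forall>P Q. P \<noteq> 0 \<longrightarrow> degree P \<le> n \<longrightarrow> Q \<noteq> 0 \<longrightarrow>
           degree Q \<le> D \<longrightarrow> ht Q \<le> X \<longrightarrow> \<bar>eval_at Q z\<bar> \<le> X powr (- t) \<longrightarrow> splits_off z c v P Q"
proof -
  obtain a where "0 < a" and a:
      "\<And>A. A \<noteq> 0 \<Longrightarrow> degree A \<le> n \<Longrightarrow> a * ht A powr (- s) \<le> \<bar>eval_at A z\<bar>"
    using w_exp_lower_bound[OF assms(1-3)] by blast
  obtain c where "0 < c" and c:
      "\<And>A. A \<noteq> 0 \<Longrightarrow> degree A \<le> k \<Longrightarrow> c * ht A powr (- v) \<le> \<bar>eval_at A z\<bar>"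
    using w_exp_lower_bound[OF assms(1,5,6)] by blast
  obtain b where "0 < b" and b: "\<And>P Q. P \<noteq> 0 \<Longrightarrow> degree P \<le> n \<Longrightarrow> Q \<noteq> 0 \<Longrightarrow> degree Q \<le> D
      \<Longrightarrow> splits_off z b s P Q"
    using split_off_w_exp[OF assms(1-3)] by blast
  define e where "e = b * a * gelfond_const D powr (- s)"
  have e: "0 < e" unfolding e_def using \<open>0 < a\<close> \<open>0 < b\<close> gelfond_const_ge_1[of D] by simp
  have "\<forall>\<^sub>F X in at_top. (1 / e) * X powr (s - t) < 1"
    using tendsto_const_mult_neg_powr[of "s - t" "1 / e"] \<open>s < t\<close> by (intro order_tendstoD) auto
  then have "\<forall>\<^sub>F X :: real in at_top. \<forall>P Q. P \<noteq> 0 \<longrightarrow> degree P \<le> n \<longrightarrow> Q \<noteq> 0 \<longrightarrow>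
           degree Q \<le> D \<longrightarrow> ht Q \<le> X \<longrightarrow> \<bar>eval_at Q z\<bar> \<le> X powr (- t) \<longrightarrow> splits_off z c v P Q"
    using eventually_gt_at_top[of "0::real"]
  proof eventually_elim
    case (elim X)
    show ?case
    proof (intro allI impI)
      fix P Q :: "int poly"
      assume P: "P \<noteq> 0" "degree P \<le> n" and Q: "Q \<noteq> 0" "degree Q \<le> D" "ht Q \<le> X"
        "\<bar>eval_at Q z\<bar> \<le> X powr (- t)"
      obtain A B where AB: "Q = A * B" "no_common_factor P B"
          "b * ht A powr (- s) \<le> \<bar>eval_at A z\<bar>"
        using b[OF P Q(1,2)] unfolding splits_off_def by blast
      have nz: "A \<noteq> 0" "B \<noteq> 0" using AB Q by auto
      have "degree A \<le> k"
      proof (rule ccontr)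
        assume "\<not> degree A \<le> k"
        moreover have "degree A + degree B \<le> D" using Q AB nz by (simp add: degree_mult_eq)
        ultimately have "degree B \<le> n" using D by linarith
        then have "e * ht Q powr (- s) \<le> \<bar>eval_at Q z\<bar>"
          using lower_bound_mult[OF _ _ \<open>0 \<le> s\<close> \<open>0 < b\<close> \<open>0 < a\<close> AB(3) a[OF nz(2)], of D] AB(1) Q
          unfolding e_def by auto
        moreover have "X powr (- s) \<le> ht Q powr (- s)"
          using Q(3) ht_ge_1[OF Q(1)] \<open>0 \<le> s\<close> by (intro powr_mono2') auto
        then have "e * X powr (- s) \<le> e * ht Q powr (- s)" using e by simp
        ultimately have "e * X powr (- s) \<le> X powr (- t)" using Q(4) by linarith
        moreover have "X powr (- t) < e * X powr (- s)"
          using elim e by (simp add: powr_diff powr_minus field_simps)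
        ultimately show False by simp
      qed
      then show "splits_off z c v P Q"
        unfolding splits_off_def using AB c[OF nz(1)] by blast
    qed
  qed
  then show ?thesis using \<open>0 < c\<close> by blast
qed

section \<open>The two bounds as instances of the common frame\<close>

theorem theorem3p1:
  fixes n :: nat and \<zeta> :: real
  assumes "n \<ge> 1"
    and "\<not> algebraic \<zeta>"
    and "w_exp n \<zeta> < \<infinity>"
  shows "(\<forall>N :: nat. \<lceil>real_of_ereal (w_exp n \<zeta>)\<rceil> + int n - 1 \<le> int N \<longrightarrow>
            lambda_exp N \<zeta> \<le> max (1 / w_hat_exp n \<zeta>)
              (1 / (w_hat_exp (N + 1 - n) \<zeta> - w_exp n \<zeta>)))
       \<and> (w_exp n \<zeta> < ereal (2 * real n + 1) \<longrightarrow>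
          (\<forall>N :: nat. \<lfloor>real_of_ereal (w_exp n \<zeta>)\<rfloor> + int n \<le> int N \<and> N \<le> 3 * n \<longrightarrow>
            lambda_exp N \<zeta> \<le> max (1 / w_hat_exp n \<zeta>)
              (1 / (w_hat_exp (N + 1 - n) \<zeta> - w_exp (N - 2 * n) \<zeta>))))"
proof (intro conjI allI impI)
  obtain q where q: "w_exp n \<zeta> = ereal q" "0 \<le> q"
    using assms(3) w_exp_nonneg[OF assms(2), of n] by (cases "w_exp n \<zeta>") auto
  {
    fix N :: nat
    assume "\<lceil>real_of_ereal (w_exp n \<zeta>)\<rceil> + int n - 1 \<le> int N"
    then have N: "\<lceil>q\<rceil> + int n \<le> int N + 1" using q by simp
    have nN: "n \<le> N + 1" using N q(2) by linarith
    \<comment> \<open>The ceiling condition places \<open>q\<close> at or below the Dirichlet bound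
      for the degree \<open>N + 1 - n\<close>.\<close>
    then have "q \<le> real (N + 1 - n)" using N by (simp add: of_nat_diff) linarith
    then have le: "ereal q \<le> w_hat_exp (N + 1 - n) \<zeta>"
      using w_hat_exp_ge[OF assms(2), of "N + 1 - n"] by (meson ereal_less_eq(3) order_trans)
    show "lambda_exp N \<zeta> \<le> max (1 / w_hat_exp n \<zeta>)
        (1 / (w_hat_exp (N + 1 - n) \<zeta> - w_exp n \<zeta>))"
      unfolding q(1)
    proof (rule lambda_exp_le_max[OF assms(2) nN q(2) le])
      \<comment> \<open>The splitting here holds whatever \<open>t\<close> is, so any real below the
        uniform exponent serves as threshold.\<close>
      show "ereal (q - 1) < w_hat_exp (N + 1 - n) \<zeta>"
        using le by (rule less_le_trans[rotated]) simp
      fix t v :: real assume "q < v"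
      then obtain c where "0 < c" "\<forall>P Q. P \<noteq> 0 \<longrightarrow> degree P \<le> n \<longrightarrow> Q \<noteq> 0 \<longrightarrow>
          degree Q \<le> N + 1 - n \<longrightarrow> splits_off \<zeta> c v P Q"
        using split_off_w_exp[OF assms(2), of n v "N + 1 - n"] q by auto
      then show "\<exists>c>0. \<forall>\<^sub>F X :: real in at_top. \<forall>P Q. P \<noteq> 0 \<longrightarrow> degree P \<le> n \<longrightarrow> Q \<noteq> 0 \<longrightarrow>
          degree Q \<le> N + 1 - n \<longrightarrow> ht Q \<le> X \<longrightarrow> \<bar>eval_at Q \<zeta>\<bar> \<le> X powr (- t) \<longrightarrow>
          splits_off \<zeta> c v P Q"
        by (intro exI[of _ c] conjI always_eventually) auto
    qed
  }
  {
    fix N :: nat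
    assume "\<lfloor>real_of_ereal (w_exp n \<zeta>)\<rfloor> + int n \<le> int N \<and> N \<le> 3 * n"
    then have N: "\<lfloor>q\<rfloor> + int n \<le> int N" "N \<le> 3 * n" using q by auto
    have nN: "n \<le> N + 1" using N q(2) by linarith
    \<comment> \<open>The floor condition yields a strict inequality, which leaves room for
      \<open>q < s < t\<close>.\<close>
    then have "q < real (N + 1 - n)" using N by (simp add: of_nat_diff) linarith
    then have lt: "ereal q < w_hat_exp (N + 1 - n) \<zeta>"
      using w_hat_exp_ge[OF assms(2), of "N + 1 - n"] by (meson less_ereal.simps(1) less_le_trans)
    have "w_exp (N - 2 * n) \<zeta> \<le> ereal q"
      using w_exp_mono[OF assms(2), of "N - 2 * n" n] N(2) q(1) by simp
    then obtain r where r: "w_exp (N - 2 * n) \<zeta> = ereal r" "0 \<le> r" "r \<le> q"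
      using w_exp_nonneg[OF assms(2), of "N - 2 * n"] by (cases "w_exp (N - 2 * n) \<zeta>") auto
    have le: "ereal r \<le> w_hat_exp (N + 1 - n) \<zeta>"
      using r(3) lt by (meson ereal_less_eq(3) less_imp_le order_trans)
    show "lambda_exp N \<zeta> \<le> max (1 / w_hat_exp n \<zeta>)
        (1 / (w_hat_exp (N + 1 - n) \<zeta> - w_exp (N - 2 * n) \<zeta>))"
      unfolding r(1)
    proof (rule lambda_exp_le_max[OF assms(2) nN r(2) le lt])
      fix t v :: real assume "q < t" "r < v"
      obtain s where s: "q < s" "s < t" using dense \<open>q < t\<close> by blast
      show "\<exists>c>0. \<forall>\<^sub>F X :: real in at_top. \<forall>P Q. P \<noteq> 0 \<longrightarrow> degree P \<le> n \<longrightarrow> Q \<noteq> 0 \<longrightarrow>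
          degree Q \<le> N + 1 - n \<longrightarrow> ht Q \<le> X \<longrightarrow> \<bar>eval_at Q \<zeta>\<bar> \<le> X powr (- t) \<longrightarrow>
          splits_off \<zeta> c v P Q"
        \<comment> \<open>The degree condition is
          \<open>N + 1 - n \<le> n + (N - 2 * n) + 1\<close>. For \<open>N < 2 * n\<close> the
          truncated difference is 0, and the convention for degree 0 applies.\<close>
        by (rule split_off_low_degree[OF assms(2), where s = s and k = "N - 2 * n"])
           (use q r s \<open>r < v\<close> in auto)
    qed
  }
qed

end
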